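(* Let $K$ be a set of positive integers and let $(\mathcal{X},\mathcal{G},\mathcal{A})$ be a GDD with groups $G_{1},\dots,G_{s}$. Suppose that $w:\mathcal{X}\rightarrow \mathbb{Z}^{+}\cup\{0\}$ is a function such that for each block $A=\{x_{1},\ldots,x_{k}\}\in\mathcal{A}$ there exist three $K$-GDDs of type $[w(x_{1}),\ldots,w(x_{k})]$ (on the same point set with the same groups) with exactly $b_{A}$ common blocks. Then there exist three $K$-GDDs of type $[\sum_{x\in G_{1}}w(x),\ldots,\sum_{x\in G_{s}}w(x)]$ (on the same point set with the same groups) which intersect in exactly $\sum_{A\in\mathcal{A}}b_{A}$ blocks.
   Context: For a set $K$ of positive integers, a $K$-GDD (group divisible design) is a triple $(\mathcal{X},\mathcal{G},\mathcal{A})$ where $\mathcal{G}$ is a partition of a finite set $\mathcal{X}$ into subsets called groups, $\mathcal{A}$ is a set of subsets of $\mathcal{X}$ (blocks) each of cardinality in $K$, a group and a block meet in at most one element, and every pair of elements from distinct groups lies in exactly one block. A GDD (without specified $K$) is a $K$-GDD for some $K$. The type $[g_1,\dots,g_s]$ (also written $g_1g_2\cdots g_s$, with exponents for repetition) lists the group sizes. Three $K$-GDDs $(\mathcal{X},\mathcal{G},\mathcal{A}_1),(\mathcal{X},\mathcal{G},\mathcal{A}_2),(\mathcal{X},\mathcal{G},\mathcal{A}_3)$ with the same points and groups are said to intersect in (have) exactly $b$ common blocks if $\mathcal{A}_1\cap\mathcal{A}_2=\mathcal{A}_1\cap\mathcal{A}_3=\mathcal{A}_2\cap\mathcal{A}_3$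 and this set has exactly $b$ blocks.
   Formalization: K is additionally assumed not to contain 1 (block sizes at least 2); with 1 in K the claim fails, e.g. K={1,2}, two points in singleton groups, all nonempty subsets as blocks, w=1, would require 5 common blocks where only 3 exist. *)

theory Defs
  imports "HOL-Library.Multiset" "HOL-Library.Disjoint_Sets"
begin

definition kgdd :: "nat set \<Rightarrow> 'p set \<Rightarrow> 'p set set \<Rightarrow> 'p set set \<Rightarrow> bool" where
  "kgdd K X \<G> \<A> \<longleftrightarrow>
     finite X \<and> partition_on X \<G> \<and>
     (\<forall>A\<in>\<A>. A \<subseteq> X \<and> card A \<in> K) \<and>
     (\<forall>G\<in>\<G>. \<forall>A\<in>\<A>. card (G \<inter> A) \<le> 1) \<and>
     (\<forall>G\<in>\<G>. \<forall>H\<in>\<G>. G \<noteq> H \<longrightarrow>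
        (\<forall>x\<in>G. \<forall>y\<in>H. \<exists>!A. A \<in> \<A> \<and> x \<in> A \<and> y \<in> A))"

definition gdd :: "'p set \<Rightarrow> 'p set set \<Rightarrow> 'p set set \<Rightarrow> bool" where
  "gdd X \<G> \<A> \<longleftrightarrow> (\<exists>K. (\<forall>k\<in>K. 0 < k) \<and> kgdd K X \<G> \<A>)"

text \<open>A type is the multiset of group sizes. Weights may vanish, so a prescribed type may
  have entries 0; as the parts of a partition are nonempty, these entries stand for no group.\<close>

definition has_type :: "'p set set \<Rightarrow> nat multiset \<Rightarrow> bool" where
  "has_type \<G> T \<longleftrightarrow> image_mset card (mset_set \<G>) = filter_mset (\<lambda>g. 0 < g) T"

definition three_kgdds_common ::
    "nat set \<Rightarrow> nat multiset \<Rightarrow> nat \<Rightarrow>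
     'p set \<Rightarrow> 'p set set \<Rightarrow> 'p set set \<Rightarrow> 'p set set \<Rightarrow> 'p set set \<Rightarrow> bool" where
  "three_kgdds_common K T b Y \<H> \<B>1 \<B>2 \<B>3 \<longleftrightarrow>
     kgdd K Y \<H> \<B>1 \<and> kgdd K Y \<H> \<B>2 \<and> kgdd K Y \<H> \<B>3 \<and> has_type \<H> T \<and>
     \<B>1 \<inter> \<B>2 = \<B>1 \<inter> \<B>3 \<and> \<B>1 \<inter> \<B>3 = \<B>2 \<inter> \<B>3 \<and> card (\<B>1 \<inter> \<B>2) = b"

text \<open>Blocks of size 1 satisfy the definition of a GDD as it stands, but they have to be kept
  out of the block sizes K of the weighting construction: they lie in no pair of distinct
  groups, so the same singleton may be a common block of the ingredients of several blocks of
  the original GDD and be counted several times. For example, take K = {1, 2}, points x and y,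
  groups {x}, {y}, blocks {x}, {y}, {x, y} and constant weight 1. There are ingredients with
  1, 1 and 3 common blocks, but no GDD of type [1, 1] with nonempty blocks has 5 blocks.\<close>

end

theory Submission
  imports Defs
begin

text \<open>Replace every point \<open>x\<close> by a fibre of \<open>w x\<close> copies and every block \<open>A\<close> by a copy of its
  ingredient on the fibres over \<open>A\<close>. A pair of points over distinct groups lies over exactly one
  block, and there in exactly one block of the ingredient. As blocks of size at least 2 meet at
  least two fibres, which lie over distinct groups, they determine the block \<open>A\<close> below them.
  Hence the common blocks are the disjoint union of the common blocks of the ingredients.\<close>

section \<open>Matching elements of equal value\<close>

text \<open>Every value is taken equally often on both sides, so elements of equal value can be
  paired off one at a time. This is what turns an equality of types into an actual assignment of
  groups to points.\<close>

lemma image_mset_mset_set_eq_imp_bij_betw: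
  assumes "finite S" "finite T" "image_mset f (mset_set S) = image_mset g (mset_set T)"
  shows "\<exists>h. bij_betw h S T \<and> (\<forall>s\<in>S. g (h s) = f s)"
  using assms
proof (induction S arbitrary: T rule: finite_induct)
  case empty
  then have "T = {}" by (simp add: mset_set_empty_iff)
  then show ?case by (simp add: bij_betw_def)
next
  case (insert s S)
  \<comment> \<open>Some \<open>t\<close> in \<open>T\<close> has the value of \<open>s\<close>.
    Pairing these two and cancelling one copy of the value leaves the same problem for
    \<open>S\<close> and \<open>T - {t}\<close>.\<close>
  have "f s \<in># image_mset g (mset_set T)"
    using insert.hyps insert.prems by (metis finite_insert finite_set_mset_mset_set image_eqI insertI1 set_image_mset)
  then obtain t where t: "t \<in> T" "g t = f s" using insert.prems by auto
  have T: "T = insert t (T - {t})" using t by auto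
  have "image_mset g (mset_set T) = add_mset (g t) (image_mset g (mset_set (T - {t})))"
    by (subst T) (simp add: insert.prems(1) del: insert_Diff_single)
  with insert t have "image_mset f (mset_set S) = image_mset g (mset_set (T - {t}))" by simp
  from insert.IH[OF _ this] insert.prems obtain h
    where h: "bij_betw h S (T - {t})" "\<forall>s\<in>S. g (h s) = f s" by auto
  let ?h = "h(s := t)"
  have "bij_betw ?h S (T - {t})"
    using h(1) insert.hyps by (subst bij_betw_cong[of S _ h]) auto
  then have "bij_betw ?h (S \<union> {s}) ((T - {t}) \<union> {?h s})"
    using insert.hyps by (subst notIn_Un_bij_betw3[symmetric]) auto
  then have "bij_betw ?h (insert s S) (insert t (T - {t}))" by simp
  then have "bij_betw ?h (insert s S) T" using T by simp
  moreover have "\<forall>u\<in>insert s S. g (?h u) = f u" using h(2) t insert.hyps by auto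
  ultimately show ?case by blast
qed

section \<open>Introduction and elimination rules for group divisible designs\<close>

lemma kgddI:
  assumes "finite X" "partition_on X \<G>"
    and "\<And>A. A \<in> \<A> \<Longrightarrow> A \<subseteq> X \<and> card A \<in> K"
    and "\<And>G A. G \<in> \<G> \<Longrightarrow> A \<in> \<A> \<Longrightarrow> card (G \<inter> A) \<le> 1"
    and "\<And>G H x y. G \<in> \<G> \<Longrightarrow> H \<in> \<G> \<Longrightarrow> G \<noteq> H \<Longrightarrow> x \<in> G \<Longrightarrow> y \<in> H \<Longrightarrow>
      \<exists>!A. A \<in> \<A> \<and> x \<in> A \<and> y \<in> A"
  shows "kgdd K X \<G> \<A>"
  unfolding kgdd_def
proof (intro conjI ballI impI)
  show "A \<subseteq> X" "card A \<in> K" if "A \<in> \<A>" for A using assms(3)[OF that] by blast+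
qed (fact assms(1,2,4,5))+

lemma kgddD:
  assumes "kgdd K X \<G> \<A>"
  shows "finite X" "partition_on X \<G>" "\<Union>\<G> = X"
    and "A \<in> \<A> \<Longrightarrow> A \<subseteq> X" "A \<in> \<A> \<Longrightarrow> card A \<in> K" "A \<in> \<A> \<Longrightarrow> finite A"
    and "G \<in> \<G> \<Longrightarrow> H \<in> \<G> \<Longrightarrow> G \<noteq> H \<Longrightarrow> G \<inter> H = {}" "G \<in> \<G> \<Longrightarrow> finite G"
    and "G \<in> \<G> \<Longrightarrow> A \<in> \<A> \<Longrightarrow> card (G \<inter> A) \<le> 1"
    and "G \<in> \<G> \<Longrightarrow> H \<in> \<G> \<Longrightarrow> G \<noteq> H \<Longrightarrow> x \<in> G \<Longrightarrow> y \<in> H \<Longrightarrow> \<exists>!A. A \<in> \<A> \<and> x \<in> A \<and> y \<in> A"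
proof -
  note d = assms[unfolded kgdd_def]
  note d2 = d[THEN conjunct2, THEN conjunct2]
  note blocks = d2[THEN conjunct1] and meet = d2[THEN conjunct2, THEN conjunct1]
    and pairs = d2[THEN conjunct2, THEN conjunct2]
  show fin: "finite X" using d by (rule conjunct1)
  show part: "partition_on X \<G>" using d[THEN conjunct2] by (rule conjunct1)
  show U: "\<Union>\<G> = X" using part by (simp add: partition_on_def)
  show sub: "A \<subseteq> X" if "A \<in> \<A>" using blocks that by blast
  show "card A \<in> K" if "A \<in> \<A>" using blocks that by blast
  show "finite A" if "A \<in> \<A>" using sub[OF that] fin by (rule finite_subset)
  show "G \<inter> H = {}" if "G \<in> \<G>" "H \<in> \<G>" "G \<noteq> H"
    using part that unfolding partition_on_def disjoint_def by blast
  show "finite G" if "G \<in> \<G>"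
    using finite_subset[OF _ fin, of G] that U by blast
  show "card (G \<inter> A) \<le> 1" if "G \<in> \<G>" "A \<in> \<A>" using meet that by blast
  show "\<exists>!A. A \<in> \<A> \<and> x \<in> A \<and> y \<in> A" if "G \<in> \<G>" "H \<in> \<G>" "G \<noteq> H" "x \<in> G" "y \<in> H"
    by (rule pairs[THEN bspec, THEN bspec, THEN mp, THEN bspec, THEN bspec, OF that])
qed

section \<open>Transport of designs along injections\<close>

text \<open>The axioms speak only of membership, intersections and cardinalities of subsets of
  \<open>Y\<close>, all of which an injection preserves. Transport is needed twice: to put the
  ingredients on the fibres, and to put the final designs on natural numbers.\<close>

lemma kgdd_image:
  assumes kg: "kgdd K Y \<H> \<B>" and inj: "inj_on f Y"
  shows "kgdd K (f ` Y) ((`) f ` \<H>) ((`) f ` \<B>)"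
proof -
  note part = kgddD(2)[OF kg] and UY = kgddD(3)[OF kg] and BY = kgddD(4)[OF kg]
    and dj = kgddD(7)[OF kg] and GB = kgddD(9)[OF kg] and pair = kgddD(10)[OF kg]
  have HY: "\<And>H. H \<in> \<H> \<Longrightarrow> H \<subseteq> Y" using UY by blast
  have ne: "{} \<notin> \<H>" using part by (simp add: partition_on_def)
  have card_f: "card (f ` S) = card S" if "S \<subseteq> Y" for S
    by (rule card_image[OF inj_on_subset[OF inj that]])
  have mem: "f x \<in> f ` S \<longleftrightarrow> x \<in> S" if "x \<in> Y" "S \<subseteq> Y" for x S
    using inj that by (rule inj_on_image_mem_iff)
  have int: "f ` G \<inter> f ` H = f ` (G \<inter> H)" if "G \<subseteq> Y" "H \<subseteq> Y" for G H
    using inj_on_image_Int[OF inj that] by simp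
  show ?thesis
  proof (rule kgddI)
    show "partition_on (f ` Y) ((`) f ` \<H>)"
      unfolding partition_on_def disjoint_def
    proof (intro conjI ballI impI)
      show "\<Union> ((`) f ` \<H>) = f ` Y" using UY by auto
      show "{} \<notin> (`) f ` \<H>" using ne by auto
      fix a b assume "a \<in> (`) f ` \<H>" "b \<in> (`) f ` \<H>" "a \<noteq> b"
      then obtain G H where "G \<in> \<H>" "H \<in> \<H>" "G \<noteq> H" "a = f ` G" "b = f ` H" by blast
      then show "a \<inter> b = {}" using int[OF HY HY] dj by simp
    qed
    show "\<exists>!A. A \<in> (`) f ` \<B> \<and> u \<in> A \<and> v \<in> A"
      if H: "G \<in> (`) f ` \<H>" "H \<in> (`) f ` \<H>" "G \<noteq> H" "u \<in> G" "v \<in> H" for G H u v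
    proof -
      obtain G' H' x y where GH: "G' \<in> \<H>" "H' \<in> \<H>" "G' \<noteq> H'" "x \<in> G'" "y \<in> H'" "u = f x" "v = f y"
        using H by blast
      have xy: "x \<in> Y" "y \<in> Y" using GH HY by auto
      from pair[OF GH(1-5)] obtain B where B: "B \<in> \<B>" "x \<in> B" "y \<in> B"
        and un: "\<And>B'. B' \<in> \<B> \<Longrightarrow> x \<in> B' \<Longrightarrow> y \<in> B' \<Longrightarrow> B' = B" by blast
      show ?thesis
      proof (rule ex1I[of _ "f ` B"])
        show "f ` B \<in> (`) f ` \<B> \<and> u \<in> f ` B \<and> v \<in> f ` B" using B GH by auto
        fix A assume "A \<in> (`) f ` \<B> \<and> u \<in> A \<and> v \<in> A"
        then obtain B' where B': "B' \<in> \<B>" "A = f ` B'" "u \<in> f ` B'" "v \<in> f ` B'" by blast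
        then have "x \<in> B'" "y \<in> B'" using mem[OF _ BY] xy GH by simp_all
        then show "A = f ` B" using un B' by simp
      qed
    qed
    show "A \<subseteq> f ` Y \<and> card A \<in> K" if "A \<in> (`) f ` \<B>" for A
      using that BY kgddD(5)[OF kg] card_f by auto
    show "card (G \<inter> A) \<le> 1" if GA: "G \<in> (`) f ` \<H>" "A \<in> (`) f ` \<B>" for G A
    proof -
      obtain G' A' where *: "G' \<in> \<H>" "A' \<in> \<B>" "G = f ` G'" "A = f ` A'" using GA by blast
      then have "card (G \<inter> A) = card (G' \<inter> A')"
        using int[OF HY BY] card_f[OF le_infI1[OF HY]] by simp
      then show ?thesis using GB * by simp
    qed
    show "finite (f ` Y)" using kgddD(1)[OF kg] by simp
  qed
qed

lemma has_type_image:
  assumes ht: "has_type \<H> T" and inj: "inj_on f Y" and sub: "\<And>H. H \<in> \<H> \<Longrightarrow> H \<subseteq> Y"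
  shows "has_type ((`) f ` \<H>) T"
proof -
  have "inj_on ((`) f) (Pow Y)" using inj by (rule inj_on_image_Pow)
  then have i: "inj_on ((`) f) \<H>" by (rule inj_on_subset) (use sub in auto)
  have c: "card (f ` H) = card H" if "H \<in> \<H>" for H
    by (rule card_image[OF inj_on_subset[OF inj sub[OF that]]])
  have "image_mset card (mset_set ((`) f ` \<H>)) = image_mset (card \<circ> (`) f) (mset_set \<H>)"
    by (simp add: image_mset_mset_set[OF i, symmetric] multiset.map_comp)
  also have "\<dots> = image_mset card (mset_set \<H>)"
    \<comment> \<open>For infinite \<open>\<H>\<close> the multiset \<open>mset_set \<H>\<close> is
      empty by convention, so its members lie in \<open>\<H>\<close> in either case.\<close>
    by (rule image_mset_cong) (metis c comp_apply elem_mset_set mset_set.infinite count_empty not_in_iff)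
  finally show ?thesis using ht by (simp add: has_type_def)
qed

text \<open>Taking images under \<open>f\<close> is itself injective on \<open>Pow Y\<close>. It
  therefore commutes with intersections of families of blocks and preserves the number of common
  blocks.\<close>

lemma three_kgdds_common_image:
  assumes tk: "three_kgdds_common K T b Y \<H> \<B>1 \<B>2 \<B>3" and inj: "inj_on f Y"
  shows "three_kgdds_common K T b (f ` Y) ((`) f ` \<H>) ((`) f ` \<B>1) ((`) f ` \<B>2) ((`) f ` \<B>3)"
proof -
  have k: "kgdd K Y \<H> \<B>1" "kgdd K Y \<H> \<B>2" "kgdd K Y \<H> \<B>3" and ht: "has_type \<H> T"
    and eq: "\<B>1 \<inter> \<B>2 = \<B>1 \<inter> \<B>3" "\<B>1 \<inter> \<B>3 = \<B>2 \<inter> \<B>3" "card (\<B>1 \<inter> \<B>2) = b"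
    using tk unfolding three_kgdds_common_def by auto
  have sub: "\<B>1 \<subseteq> Pow Y" "\<B>2 \<subseteq> Pow Y" "\<B>3 \<subseteq> Pow Y" and HY: "\<And>H. H \<in> \<H> \<Longrightarrow> H \<subseteq> Y"
    using k[THEN kgddD(4)] kgddD(3)[OF k(1)] by blast+
  have iP: "inj_on ((`) f) (Pow Y)" using inj by (rule inj_on_image_Pow)
  have int: "(`) f ` S \<inter> (`) f ` T = (`) f ` (S \<inter> T)" if "S \<subseteq> Pow Y" "T \<subseteq> Pow Y" for S T
    using inj_on_image_Int[OF iP that] by simp
  have "card ((`) f ` (\<B>1 \<inter> \<B>2)) = b"
    using card_image[of "(`) f" "\<B>1 \<inter> \<B>2"] inj_on_subset[OF iP, of "\<B>1 \<inter> \<B>2"] sub eq(3) by auto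
  then show ?thesis
    unfolding three_kgdds_common_def
    using kgdd_image[OF k(1) inj] kgdd_image[OF k(2) inj] kgdd_image[OF k(3) inj]
      has_type_image[OF ht inj HY] int sub eq by simp
qed

section \<open>Fibres over points and ingredients placed on them\<close>

text \<open>The fibre over \<open>x\<close> depends on \<open>x\<close> alone, not on a block
  through it, so ingredients over different blocks automatically share the fibres over their common
  points. A point of weight 0 disappears.\<close>

definition inflate :: "('a \<Rightarrow> nat) \<Rightarrow> 'a set \<Rightarrow> ('a \<times> nat) set" where
  "inflate w S = Sigma S (\<lambda>x. {..<w x})"

lemma mem_inflate [simp]: "(x, i) \<in> inflate w S \<longleftrightarrow> x \<in> S \<and> i < w x"
  by (simp add: inflate_def)

lemma finite_inflate: "finite S \<Longrightarrow> finite (inflate w S)"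
  by (simp add: inflate_def)

lemma card_inflate: "finite S \<Longrightarrow> card (inflate w S) = (\<Sum>x\<in>S. w x)"
  by (simp add: inflate_def)

text \<open>The groups of the ingredient over \<open>A\<close>. Points of weight 0 are left out
  because the parts of a partition are nonempty.\<close>

definition fibres :: "('a \<Rightarrow> nat) \<Rightarrow> 'a set \<Rightarrow> ('a \<times> nat) set set" where
  "fibres w A = (\<lambda>x. inflate w {x}) ` {x \<in> A. 0 < w x}"

text \<open>The given ingredient lives on an arbitrary set \<open>Y\<close>. Matching its groups
  with the points of \<open>A\<close> so that sizes become weights, and numbering each group, gives
  a bijection onto \<open>inflate w A\<close> that carries groups to fibres. One bijection serves
  all three designs, as they share points and groups.\<close>

lemma three_kgdds_common_on_inflate:
  fixes Y :: "'b set" and A :: "'a set"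
  assumes fin: "finite A"
    and tk: "three_kgdds_common K (image_mset w (mset_set A)) b Y \<H> \<B>1 \<B>2 \<B>3"
  shows "\<exists>\<C>1 \<C>2 \<C>3. three_kgdds_common K (image_mset w (mset_set A)) b
    (inflate w A) (fibres w A) \<C>1 \<C>2 \<C>3"
proof -
  have "kgdd K Y \<H> \<B>1" and ht: "has_type \<H> (image_mset w (mset_set A))"
    using tk unfolding three_kgdds_common_def by auto
  note part = kgddD(1,2)[OF \<open>kgdd K Y \<H> \<B>1\<close>] and HY = kgddD(3)[OF \<open>kgdd K Y \<H> \<B>1\<close>]
    and dj = kgddD(7)[OF \<open>kgdd K Y \<H> \<B>1\<close>] and finE = kgddD(8)[OF \<open>kgdd K Y \<H> \<B>1\<close>]
  have finH: "finite \<H>" using part by (rule finite_elements)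
  let ?A = "{x \<in> A. 0 < w x}"
  \<comment> \<open>Zero entries of the type stand for no group, so the group sizes are exactly the
    positive weights on \<open>A\<close>.\<close>
  have "image_mset card (mset_set \<H>) = image_mset w (mset_set ?A)"
    using ht fin by (simp add: has_type_def filter_mset_image_mset)
  from image_mset_mset_set_eq_imp_bij_betw[OF finH _ this] fin
  obtain h where h: "bij_betw h \<H> ?A" and wh: "\<And>H. H \<in> \<H> \<Longrightarrow> w (h H) = card H" by auto
  \<comment> \<open>Each group is numbered from 0. As \<open>card H\<close> equals
    \<open>w (h H)\<close>, the numbers are the second coordinates in the fibre over
    \<open>h H\<close>.\<close>
  have "\<exists>e. bij_betw e H {..<card H}" if "H \<in> \<H>" for H
    using ex_bij_betw_finite_nat[OF finE[OF that]] by (simp add: atLeast0LessThan)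
  then obtain e where e: "\<And>H. H \<in> \<H> \<Longrightarrow> bij_betw (e H) H {..<card H}" by metis
  define grp where "grp y = (THE H. H \<in> \<H> \<and> y \<in> H)" for y
  have grp: "grp y = H" if "H \<in> \<H>" "y \<in> H" for y H
    unfolding grp_def using that dj by (intro the_equality) blast+
  \<comment> \<open>The first coordinate is the point matched with the group of \<open>y\<close>,
    the second the number of \<open>y\<close> within that group.\<close>
  define f where "f y = (h (grp y), e (grp y) y)" for y
  have fH: "f ` H = inflate w {h H}" if H: "H \<in> \<H>" for H
  proof -
    have "f ` H = {h H} \<times> e H ` H" using grp[OF H] by (auto simp: f_def)
    then show ?thesis using e[OF H] wh[OF H] by (auto simp: inflate_def bij_betw_def)
  qed
  have inj: "inj_on f Y"
  proof (rule inj_onI)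
    fix x y assume "x \<in> Y" "y \<in> Y" and eq: "f x = f y"
    then obtain G H where G: "G \<in> \<H>" "x \<in> G" and H: "H \<in> \<H>" "y \<in> H" using HY by auto
    have "h G = h H" using eq grp[OF G] grp[OF H] by (simp add: f_def)
    then have "G = H" using h G H by (auto simp: bij_betw_def inj_on_def)
    then have "e G x = e G y" using eq grp[OF G] grp[OF H] by (simp add: f_def)
    then show "x = y" using e[OF G(1)] G H \<open>G = H\<close> by (auto simp: bij_betw_def inj_on_def)
  qed
  have hH: "h ` \<H> = ?A" using h by (simp add: bij_betw_def)
  have 1: "(`) f ` \<H> = fibres w A"
    unfolding fibres_def hH[symmetric] image_image using fH by (intro image_cong) auto
  have "f ` Y = \<Union> ((`) f ` \<H>)" using HY by auto
  also have "\<dots> = inflate w A" unfolding 1 by (auto simp: fibres_def inflate_def)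
  finally have 2: "f ` Y = inflate w A" .
  show ?thesis using three_kgdds_common_image[OF tk inj] unfolding 1 2 by blast
qed

section \<open>The inflated design\<close>

text \<open>Each axiom is checked first on the original design and then inside one ingredient. A
  group of total weight 0 inflates to the empty set, which is removed because it cannot be a part of
  a partition.\<close>

lemma kgdd_inflate:
  assumes kg: "kgdd L X \<G> \<A>"
    and ing: "\<And>A. A \<in> \<A> \<Longrightarrow> kgdd K (inflate w A) (fibres w A) (\<C> A)"
  shows "kgdd K (inflate w X) (inflate w ` \<G> - {{}}) (\<Union>A\<in>\<A>. \<C> A)"
proof -
  note finX = kgddD(1)[OF kg] and UX = kgddD(3)[OF kg] and AX = kgddD(4)[OF kg]
    and dj = kgddD(7)[OF kg] and GA = kgddD(9)[OF kg] and pair = kgddD(10)[OF kg]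
  note CA = kgddD(4)[OF ing] and CK = kgddD(5)[OF ing] and Cf = kgddD(9)[OF ing]
    and Cp = kgddD(10)[OF ing]
  show ?thesis
  proof (rule kgddI)
    show "finite (inflate w X)" using finX by (rule finite_inflate)
    show "partition_on (inflate w X) (inflate w ` \<G> - {{}})"
      unfolding partition_on_def disjoint_def
    proof (intro conjI ballI impI)
      show "\<Union> (inflate w ` \<G> - {{}}) = inflate w X" unfolding UX[symmetric] by (auto simp: inflate_def)
      fix a b assume "a \<in> inflate w ` \<G> - {{}}" "b \<in> inflate w ` \<G> - {{}}" "a \<noteq> b"
      then obtain G H where "G \<in> \<G>" "H \<in> \<G>" "G \<noteq> H" "a = inflate w G" "b = inflate w H" by auto
      then show "a \<inter> b = {}" using dj[of G H] by (auto simp: inflate_def)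
    qed auto
    show "B \<subseteq> inflate w X \<and> card B \<in> K" if "B \<in> (\<Union>A\<in>\<A>. \<C> A)" for B
      using that CA CK AX by (fastforce simp: inflate_def)
    show "card (F \<inter> B) \<le> 1" if F: "F \<in> inflate w ` \<G> - {{}}" and B: "B \<in> (\<Union>A\<in>\<A>. \<C> A)" for F B
    proof -
      obtain G A where G: "G \<in> \<G>" "F = inflate w G" and A: "A \<in> \<A>" "B \<in> \<C> A" using F B by auto
      have finB: "finite B" using CA[OF A] finite_inflate AX[OF A(1)] finX by (meson finite_subset)
      \<comment> \<open>The meeting condition is used on both levels: \<open>G\<close> meets
        \<open>A\<close> in at most one point, so \<open>p\<close> and \<open>q\<close> lie in one
        fibre, and this fibre, a group of the ingredient, meets \<open>B\<close> at most
        once.\<close>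
      have "p = q" if p: "p \<in> F \<inter> B" and q: "q \<in> F \<inter> B" for p q
      proof -
        obtain x i y j where pq: "p = (x, i)" "q = (y, j)" by (cases p, cases q)
        have xy: "x \<in> G \<inter> A" "y \<in> G \<inter> A" and "i < w x" "j < w y"
          using p q CA[OF A] unfolding G pq by auto
        moreover have "finite (G \<inter> A)" using finX AX[OF A(1)] by (meson finite_Int finite_subset)
        ultimately have "x = y" using GA[OF G(1) A(1)] by (metis One_nat_def card_le_Suc0_iff_eq)
        then have mem: "p \<in> inflate w {x} \<inter> B" "q \<in> inflate w {x} \<inter> B"
          using p q \<open>i < w x\<close> \<open>j < w y\<close> pq by auto
        have "inflate w {x} \<in> fibres w A" using xy \<open>i < w x\<close> by (auto simp: fibres_def)
        from Cf[OF A(1) this A(2)] mem show "p = q"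
          using finB by (metis One_nat_def card_le_Suc0_iff_eq finite_Int)
      qed
      then show ?thesis using finB by (simp add: card_le_Suc0_iff_eq)
    qed
    show "\<exists>!B. B \<in> (\<Union>A\<in>\<A>. \<C> A) \<and> p \<in> B \<and> q \<in> B"
      if F: "F \<in> inflate w ` \<G> - {{}}" and F': "F' \<in> inflate w ` \<G> - {{}}" and ne: "F \<noteq> F'"
        and p: "p \<in> F" and q: "q \<in> F'" for F F' p q
    proof -
      obtain G H where GH: "G \<in> \<G>" "H \<in> \<G>" "F = inflate w G" "F' = inflate w H" using F F' by auto
      obtain x i y j where pq: "p = (x, i)" "q = (y, j)" by (cases p, cases q)
      have mem: "x \<in> G" "y \<in> H" "i < w x" "j < w y" "G \<noteq> H" using p q GH pq ne by auto
      then have "x \<noteq> y" using dj GH by auto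
      from pair[OF GH(1,2) mem(5,1,2)] obtain A where A: "A \<in> \<A>" "x \<in> A" "y \<in> A"
        and Aun: "\<And>A'. A' \<in> \<A> \<Longrightarrow> x \<in> A' \<Longrightarrow> y \<in> A' \<Longrightarrow> A' = A" by blast
      have "inflate w {x} \<in> fibres w A" "inflate w {y} \<in> fibres w A"
        using A mem by (auto simp: fibres_def)
      \<comment> \<open>The last claim separates the two fibres, as the pair condition of the
        ingredient asks for distinct groups.\<close>
      moreover have "p \<in> inflate w {x}" "q \<in> inflate w {y}" "p \<notin> inflate w {y}"
        using pq mem \<open>x \<noteq> y\<close> by auto
      ultimately obtain B where B: "B \<in> \<C> A" "p \<in> B" "q \<in> B"
        and Bun: "\<And>B'. B' \<in> \<C> A \<Longrightarrow> p \<in> B' \<Longrightarrow> q \<in> B' \<Longrightarrow> B' = B"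
        using Cp[OF A(1), of "inflate w {x}" "inflate w {y}" p q] by blast
      show ?thesis
      proof (rule ex1I[of _ B])
        show "B \<in> (\<Union>A\<in>\<A>. \<C> A) \<and> p \<in> B \<and> q \<in> B" using A B by auto
        fix B' assume B': "B' \<in> (\<Union>A\<in>\<A>. \<C> A) \<and> p \<in> B' \<and> q \<in> B'"
        then obtain A' where A': "A' \<in> \<A>" "B' \<in> \<C> A'" by auto
        \<comment> \<open>A competing block projects into \<open>A'\<close>, so \<open>A'\<close>
          contains both base points and must be \<open>A\<close>.\<close>
        then have "x \<in> A'" "y \<in> A'" using CA[OF A'] B' pq by auto
        then have "A' = A" using Aun A' by auto
        then show "B' = B" using Bun A' B' by auto
      qed
    qed
  qed
qed

text \<open>The families \<open>\<B>\<close> and \<open>\<B>'\<close> may come from different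
  designs. Hence the lemma serves both to intersect two inflated designs and to separate the
  contributions of different blocks to the count.\<close>

lemma inflate_block_unique:
  assumes kg: "kgdd L X \<G> \<A>"
    and A: "A \<in> \<A>" "kgdd K (inflate w A) (fibres w A) \<B>" "B \<in> \<B>"
    and A': "A' \<in> \<A>" "kgdd K (inflate w A') (fibres w A') \<B>'" "B \<in> \<B>'"
    and K: "\<forall>k\<in>K. 1 < k"
  shows "A = A'"
proof -
  have BA: "B \<subseteq> inflate w A" "B \<subseteq> inflate w A'" and "card B \<in> K"
    and Bf: "\<And>F. F \<in> fibres w A \<Longrightarrow> card (F \<inter> B) \<le> 1"
    using kgddD(4,5)[OF A(2) A(3)] kgddD(4)[OF A'(2,3)] kgddD(9)[OF A(2) _ A(3)] by blast+
  then have c: "1 < card B" using K by blast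
  \<comment> \<open>An infinite set would have cardinality 0.\<close>
  then have finB: "finite B" by (metis card.infinite not_less0)
  from c obtain p q where pq: "p \<in> B" "q \<in> B" "p \<noteq> q"
    using finB by (metis One_nat_def card_le_Suc0_iff_eq not_less)
  obtain x i y j where xy: "p = (x, i)" "q = (y, j)" by (cases p, cases q)
  have mem: "x \<in> A" "y \<in> A" "x \<in> A'" "y \<in> A'" "i < w x" "j < w y" using BA pq xy by auto
  \<comment> \<open>Otherwise two points of \<open>B\<close> would lie in one fibre, which is a
    group of the ingredient.\<close>
  have "x \<noteq> y"
  proof
    assume "x = y"
    then have "p \<in> inflate w {x} \<inter> B" "q \<in> inflate w {x} \<inter> B" using pq xy mem by auto
    moreover have "inflate w {x} \<in> fibres w A" using mem by (auto simp: fibres_def)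
    ultimately show False
      using Bf pq(3) finB by (metis One_nat_def card_le_Suc0_iff_eq finite_Int)
  qed
  have AX: "A \<subseteq> X" and fin: "finite A" and GX: "\<Union>\<G> = X"
    and GA: "\<And>G. G \<in> \<G> \<Longrightarrow> card (G \<inter> A) \<le> 1"
    using kgddD(3)[OF kg] kgddD(4,6)[OF kg A(1)] kgddD(9)[OF kg _ A(1)] by blast+
  obtain G H where GH: "G \<in> \<G>" "H \<in> \<G>" "x \<in> G" "y \<in> H" using mem AX GX by blast
  \<comment> \<open>The block \<open>A\<close> contains \<open>x\<close> and \<open>y\<close> but
    meets each group at most once, so the pair lies in no other block.\<close>
  have "G \<noteq> H"
    using GA[OF GH(1)] GH mem \<open>x \<noteq> y\<close> fin
    by (metis IntI One_nat_def card_le_Suc0_iff_eq finite_Int)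
  then have "\<exists>!A. A \<in> \<A> \<and> x \<in> A \<and> y \<in> A" using kgddD(10)[OF kg GH(1,2) _ GH(3,4)] by blast
  then show ?thesis using A(1) A'(1) mem by blast
qed

text \<open>The size of an inflated group is its total weight, so removing the empty set from the
  groups matches the removal of zeros in \<open>has_type\<close>.\<close>

lemma has_type_inflate:
  assumes finX: "finite X" and part: "partition_on X \<G>"
  shows "has_type (inflate w ` \<G> - {{}}) (image_mset (\<lambda>G. \<Sum>x\<in>G. w x) (mset_set \<G>))"
proof -
  have finG: "finite \<G>" using finX part by (rule finite_elements)
  have fin: "finite G" if "G \<in> \<G>" for G
    using that finX part by (metis Union_upper finite_subset partition_on_def)
  have dj: "\<And>G H. G \<in> \<G> \<Longrightarrow> H \<in> \<G> \<Longrightarrow> G \<noteq> H \<Longrightarrow> G \<inter> H = {}"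
    using part unfolding partition_on_def disjoint_def by auto
  let ?S = "{G \<in> \<G>. 0 < (\<Sum>x\<in>G. w x)}"
  have pos: "0 < (\<Sum>x\<in>G. w x) \<longleftrightarrow> inflate w G \<noteq> {}" if "G \<in> \<G>" for G
    using card_inflate[OF fin[OF that], of w] finite_inflate[OF fin[OF that], of w]
    by (metis card_gt_0_iff)
  have im: "inflate w ` \<G> - {{}} = inflate w ` ?S" using pos by auto
  \<comment> \<open>Injectivity keeps the multiplicities of equal group sizes. It rests on the
    restriction to positive total weight: nonempty inflations of disjoint groups differ, while all
    groups of total weight 0 inflate to the empty set.\<close>
  have inj: "inj_on (inflate w) ?S"
  proof (rule inj_onI)
    fix G H assume G: "G \<in> ?S" and H: "H \<in> ?S" and eq: "inflate w G = inflate w H"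
    then obtain x i where "(x, i) \<in> inflate w G" using pos[of G] by fastforce
    then have "(x, i) \<in> inflate w G" "(x, i) \<in> inflate w H" unfolding eq by simp_all
    then have "x \<in> G \<inter> H" by simp
    then show "G = H" using dj G H by blast
  qed
  have "image_mset card (mset_set (inflate w ` ?S)) = image_mset (\<lambda>G. card (inflate w G)) (mset_set ?S)"
    by (simp add: image_mset_mset_set[OF inj, symmetric] multiset.map_comp comp_def)
  also have "\<dots> = image_mset (\<lambda>G. \<Sum>x\<in>G. w x) (mset_set ?S)"
    using finG fin by (intro image_mset_cong) (auto simp: card_inflate)
  finally show ?thesis
    unfolding has_type_def im using finG by (simp add: filter_mset_image_mset)
qed

section \<open>Assembling the three designs and counting their common blocks\<close>

theorem theorem3p1:
  fixes K :: "nat set"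
    and X :: "'a set" and \<G> \<A> :: "'a set set"
    and w :: "'a \<Rightarrow> nat" and b :: "'a set \<Rightarrow> nat"
  assumes K_pos: "\<forall>k\<in>K. 0 < k"
    and K_not1: "1 \<notin> K"
    and gdd: "gdd X \<G> \<A>"
    and ingredients: "\<forall>A\<in>\<A>. \<exists>(Y :: 'b set) \<H> \<B>1 \<B>2 \<B>3.
           three_kgdds_common K (image_mset w (mset_set A)) (b A) Y \<H> \<B>1 \<B>2 \<B>3"
  shows "\<exists>(Y :: nat set) \<H> \<B>1 \<B>2 \<B>3.
           three_kgdds_common K (image_mset (\<lambda>G. \<Sum>x\<in>G. w x) (mset_set \<G>)) (\<Sum>A\<in>\<A>. b A)
             Y \<H> \<B>1 \<B>2 \<B>3"
proof -
  have K: "\<forall>k\<in>K. 1 < k" using K_pos K_not1 by (metis One_nat_def Suc_lessI)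
  obtain L where kg: "kgdd L X \<G> \<A>" using gdd unfolding gdd_def by auto
  then have finX: "finite X" and part: "partition_on X \<G>" and AX: "\<A> \<subseteq> Pow X"
    using kgddD(1,2,4)[OF kg] by blast+
  have finA: "finite \<A>" using AX finX by (simp add: finite_subset)
  \<comment> \<open>The ingredients of \<open>A\<close> are moved to points and groups determined by
    \<open>A\<close> and \<open>w\<close>, so that the triples chosen for all blocks fit
    together.\<close>
  have "\<exists>\<C>1 \<C>2 \<C>3. three_kgdds_common K (image_mset w (mset_set A)) (b A)
      (inflate w A) (fibres w A) \<C>1 \<C>2 \<C>3" if A: "A \<in> \<A>" for A
  proof -
    have "finite A" using A AX finX by (auto intro: finite_subset)
    with A ingredients three_kgdds_common_on_inflate show ?thesis by blast
  qed
  then obtain \<C>1 \<C>2 \<C>3 where C: "\<And>A. A \<in> \<A> \<Longrightarrow> three_kgdds_common K (image_mset w (mset_set A)) (b A)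
      (inflate w A) (fibres w A) (\<C>1 A) (\<C>2 A) (\<C>3 A)" by metis
  let ?U = "\<lambda>\<C>. \<Union>A\<in>\<A>. \<C> A"
  have k: "kgdd K (inflate w A) (fibres w A) (\<C>1 A)" "kgdd K (inflate w A) (fibres w A) (\<C>2 A)"
      "kgdd K (inflate w A) (fibres w A) (\<C>3 A)"
    and eq: "\<C>1 A \<inter> \<C>2 A = \<C>1 A \<inter> \<C>3 A" "\<C>1 A \<inter> \<C>3 A = \<C>2 A \<inter> \<C>3 A" "card (\<C>1 A \<inter> \<C>2 A) = b A"
    if "A \<in> \<A>" for A
    using C[OF that] unfolding three_kgdds_common_def by auto
  \<comment> \<open>A block common to both unions could come from ingredients over different blocks
    of \<open>\<A>\<close>; uniqueness of the block below excludes this, so the intersection can be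
    formed block by block.\<close>
  have int: "?U \<C> \<inter> ?U \<D> = (\<Union>A\<in>\<A>. \<C> A \<inter> \<D> A)"
    if "\<And>A. A \<in> \<A> \<Longrightarrow> kgdd K (inflate w A) (fibres w A) (\<C> A)"
      "\<And>A. A \<in> \<A> \<Longrightarrow> kgdd K (inflate w A) (fibres w A) (\<D> A)" for \<C> \<D>
    using inflate_block_unique[OF kg _ that(1) _ _ that(2) _ K] by blast
  have i12: "?U \<C>1 \<inter> ?U \<C>2 = (\<Union>A\<in>\<A>. \<C>1 A \<inter> \<C>2 A)" by (rule int[OF k(1,2)])
  have i13: "?U \<C>1 \<inter> ?U \<C>3 = (\<Union>A\<in>\<A>. \<C>1 A \<inter> \<C>3 A)" by (rule int[OF k(1,3)])
  have i23: "?U \<C>2 \<inter> ?U \<C>3 = (\<Union>A\<in>\<A>. \<C>2 A \<inter> \<C>3 A)" by (rule int[OF k(2,3)])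
  \<comment> \<open>The same uniqueness, now within the first design, makes the union disjoint, so
    nothing is counted twice.\<close>
  have "card (\<Union>A\<in>\<A>. \<C>1 A \<inter> \<C>2 A) = (\<Sum>A\<in>\<A>. card (\<C>1 A \<inter> \<C>2 A))"
  proof (rule card_UN_disjoint[OF finA])
    show "\<forall>A\<in>\<A>. finite (\<C>1 A \<inter> \<C>2 A)"
    proof
      fix A assume "A \<in> \<A>"
      from k(1)[OF this] have "\<C>1 A \<subseteq> Pow (inflate w A)" "finite (inflate w A)"
        using kgddD(1,4) by blast+
      then show "finite (\<C>1 A \<inter> \<C>2 A)" by (meson finite_Int finite_Pow_iff finite_subset)
    qed
    show "\<forall>A\<in>\<A>. \<forall>A'\<in>\<A>. A \<noteq> A' \<longrightarrow> \<C>1 A \<inter> \<C>2 A \<inter> (\<C>1 A' \<inter> \<C>2 A') = {}"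
      using inflate_block_unique[OF kg _ k(1) _ _ k(1) _ K] by blast
  qed
  then have card: "card (?U \<C>1 \<inter> ?U \<C>2) = (\<Sum>A\<in>\<A>. b A)" unfolding i12 using eq(3) by simp
  have e12: "?U \<C>1 \<inter> ?U \<C>2 = ?U \<C>1 \<inter> ?U \<C>3" unfolding i12 i13 using eq(1) by auto
  have e13: "?U \<C>1 \<inter> ?U \<C>3 = ?U \<C>2 \<inter> ?U \<C>3" unfolding i23 i13 using eq(2) by auto
  have main: "three_kgdds_common K (image_mset (\<lambda>G. \<Sum>x\<in>G. w x) (mset_set \<G>)) (\<Sum>A\<in>\<A>. b A)
      (inflate w X) (inflate w ` \<G> - {{}}) (?U \<C>1) (?U \<C>2) (?U \<C>3)"
    unfolding three_kgdds_common_def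
    using kgdd_inflate[OF kg k(1)] kgdd_inflate[OF kg k(2)] kgdd_inflate[OF kg k(3)]
      has_type_inflate[OF finX part, of w] card e12 e13 by blast
  \<comment> \<open>The inflated point set consists of pairs; being finite, it embeds into the
    natural numbers.\<close>
  obtain f :: "'a \<times> nat \<Rightarrow> nat" where "inj_on f (inflate w X)"
    using finite_imp_inj_to_nat_seg[OF finite_inflate[OF finX]] by metis
  from three_kgdds_common_image[OF main this] show ?thesis by blast
qed

end
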